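(* Let $(V,d)$ be a differential associative superalgebra with product $\cdot$, let $(W,d)\subset (V,d)$ be a subcomplex (not assumed to be a subalgebra), and suppose there is an odd linear operator $Q:V\to V$ such that $(1-[d,Q])v\in W$ for every $v\in V$. Let $\lambda_n:\otimes^n V\to V$, $n\ge 2$, be the linear maps defined recursively from $d,Q,\cdot$ as in the context. Then the linear maps $\mu_k:\otimes^k W\to W$, $k\ge 1$, defined by $$\mu_1:=d,\qquad \mu_k:=(1-[d,Q])\,\lambda_k\quad\text{for } k\ge 2,$$ satisfy the higher order associativity identities $$\sum_{k+l=n+1,\ k,l\ge 1}\ \sum_{j=0}^{k-1}(-1)^r\mu_k\bigl(v_1,\ldots,v_j,\mu_l(v_{j+1},\ldots,v_{j+l}),v_{j+l+1},\ldots,v_n\bigr)=0,$$ $$r=l(\tilde v_1+\cdots+\tilde v_j)+j(l-1)+(k-1)l,$$ for all $n\ge 1$ and all homogeneous $v_1,\ldots,v_n\in W$. Thus there exists on $W$ a structure of $A_\infty$-algebra.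
   Context: All vector spaces are over a fixed ground field. A vector superspace is a $\mathbb{Z}/2$-graded vector space; $\tilde v$ denotes the parity of a homogeneous element $v$. Formulas with signs are stated for homogeneous elements and extended multilinearly. A differential associative superalgebra $(V,d)$ is an associative superalgebra $V$ (product $\cdot$, even) with an odd linear map $d:V\to V$, $d^2=0$, satisfying $d(v_1\cdot v_2)=(dv_1)\cdot v_2+(-1)^{\tilde v_1}v_1\cdot(dv_2)$. A subcomplex $W\subset V$ is a (graded) vector subspace with $dW\subset W$. For odd operators, $[d,Q]=dQ+Qd$ is the supercommutator. Definition of $\lambda_n$: $\lambda_2(v_1,v_2):=v_1\cdot v_2$, and for $n\ge 3$ $$\lambda_n(v_1,\ldots,v_n):=(-1)^{n-1}[Q\lambda_{n-1}(v_1,\ldots,v_{n-1})]\cdot v_n-(-1)^{n\tilde v_1}v_1\cdot[Q\lambda_{n-1}(v_2,\ldots,v_n)]$$ $$-\sum_{k+l=n,\ k,l\ge 2}(-1)^{k+(l-1)(\tilde v_1+\cdots+\tilde v_k)}[Q\lambda_k(v_1,\ldots,v_k)]\cdot[Q\lambda_l(v_{k+1},\ldots,v_n)].$$ An $A_\infty$-algebra (strong homotopy algebra) is a vector superspace $W$ with linear maps $\mu_k:\otimes^kW\to W$, $k\ge1$, of parity $k \bmod 2$, satisfying the higher order associativity identities displayed in the claim for every $n\ge1$. *)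

theory Defs
  imports Complex_Main
begin

text \<open>
  A superspace is an internal direct sum of an even part \<open>V0\<close> and an odd part \<open>V1\<close>.
  Parities are natural numbers that matter only modulo 2; the zero vector has both parities.
\<close>

definition homog :: "'v set \<Rightarrow> 'v set \<Rightarrow> nat \<Rightarrow> 'v set" where
  "homog V0 V1 p = (if even p then V0 else V1)"

locale vector_superspace = vector_space scale
  for scale :: "'k::field \<Rightarrow> 'v::ab_group_add \<Rightarrow> 'v" +
  fixes V V0 V1 :: "'v set"
  assumes subspace_even: "subspace V0"
    and subspace_odd: "subspace V1"
    and even_Int_odd: "V0 \<inter> V1 = {0}"
    and carrier_eq: "V = {a + b | a b. a \<in> V0 \<and> b \<in> V1}"

definition odd_operator ::
  "('k::field \<Rightarrow> 'v::ab_group_add \<Rightarrow> 'v) \<Rightarrow> 'v set \<Rightarrow> 'v set \<Rightarrow> ('v \<Rightarrow> 'v) \<Rightarrow> bool" where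
  "odd_operator scale V0 V1 f \<longleftrightarrow>
     Vector_Spaces.linear scale scale f \<and>
     (\<forall>p. \<forall>v \<in> homog V0 V1 p. f v \<in> homog V0 V1 (p + 1))"

text \<open>The superalgebra is not required to have a unit.\<close>

locale diff_assoc_superalgebra = vector_superspace scale UNIV V0 V1
  for scale :: "'k::field \<Rightarrow> 'v::ab_group_add \<Rightarrow> 'v" and V0 V1 :: "'v set" +
  fixes mult :: "'v \<Rightarrow> 'v \<Rightarrow> 'v" and d :: "'v \<Rightarrow> 'v"
  assumes mult_linear_right: "\<And>v. Vector_Spaces.linear scale scale (\<lambda>w. mult v w)"
    and mult_linear_left: "\<And>w. Vector_Spaces.linear scale scale (\<lambda>v. mult v w)"
    and mult_assoc: "\<And>u v w. mult (mult u v) w = mult u (mult v w)"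
    and mult_even: "\<And>p q v w. v \<in> homog V0 V1 p \<Longrightarrow> w \<in> homog V0 V1 q \<Longrightarrow>
                      mult v w \<in> homog V0 V1 (p + q)"
    and d_odd: "odd_operator scale V0 V1 d"
    and d_d: "\<And>v. d (d v) = 0"
    and d_mult: "\<And>p q v w. v \<in> homog V0 V1 p \<Longrightarrow> w \<in> homog V0 V1 q \<Longrightarrow>
                   d (mult v w) = mult (d v) w + scale ((-1) ^ p) (mult v (d w))"

definition subcomplex ::
  "('k::field \<Rightarrow> 'v::ab_group_add \<Rightarrow> 'v) \<Rightarrow> 'v set \<Rightarrow> 'v set \<Rightarrow> ('v \<Rightarrow> 'v) \<Rightarrow> 'v set \<Rightarrow> bool" where
  "subcomplex scale V0 V1 d W \<longleftrightarrow>
     vector_superspace scale W (W \<inter> V0) (W \<inter> V1) \<and> d ` W \<subseteq> W"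

text \<open>The supercommutator of two odd operators.\<close>

definition odd_commutator :: "('v::ab_group_add \<Rightarrow> 'v) \<Rightarrow> ('v \<Rightarrow> 'v) \<Rightarrow> 'v \<Rightarrow> 'v" where
  "odd_commutator d Q v = d (Q v) + Q (d v)"

text \<open>
  The recursion for \<open>\<lambda>\<^sub>n\<close> on homogeneous arguments. The argument is the list of
  the pairs \<open>(parity of v\<^sub>i, v\<^sub>i)\<close>; lists of length below 2 get the dummy value 0.
\<close>

function lambda_homog ::
  "('k::field \<Rightarrow> 'v::ab_group_add \<Rightarrow> 'v) \<Rightarrow> ('v \<Rightarrow> 'v \<Rightarrow> 'v) \<Rightarrow> ('v \<Rightarrow> 'v) \<Rightarrow> (nat \<times> 'v) list \<Rightarrow> 'v"
where
  "lambda_homog scale mult Q xs =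
    (if length xs < 2 then 0
     else if length xs = 2 then mult (snd (xs ! 0)) (snd (xs ! 1))
     else
       scale ((-1) ^ (length xs - 1))
         (mult (Q (lambda_homog scale mult Q (butlast xs))) (snd (last xs)))
       - scale ((-1) ^ (length xs * fst (hd xs)))
         (mult (snd (hd xs)) (Q (lambda_homog scale mult Q (tl xs))))
       - (\<Sum>(k, l) \<in> {(k, l). k + l = length xs \<and> k \<ge> 2 \<and> l \<ge> 2}.
           scale ((-1) ^ (k + (l - 1) * sum_list (map fst (take k xs))))
             (mult (Q (lambda_homog scale mult Q (take k xs)))
                   (Q (lambda_homog scale mult Q (drop k xs))))))"
  by pat_completeness auto
termination
  by (relation "measure (\<lambda>(scale, mult, Q, xs). length xs)") auto

declare lambda_homog.simps [simp del]

definition component :: "'v::ab_group_add set \<Rightarrow> 'v set \<Rightarrow> nat \<Rightarrow> 'v \<Rightarrow> 'v" where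
  "component V0 V1 p v = (THE a. a \<in> homog V0 V1 p \<and> v - a \<in> homog V0 V1 (p + 1))"

text \<open>
  The multilinear extension of the recursion: split every argument into its even and odd component
  and sum over all choices of parities. A linear map on the \<open>n\<close>-th tensor power is represented by
  an \<open>n\<close>-linear map on lists of length \<open>n\<close>, and the list length selects the member of
  the family.
\<close>

definition lambda ::
  "('k::field \<Rightarrow> 'v::ab_group_add \<Rightarrow> 'v) \<Rightarrow> 'v set \<Rightarrow> 'v set \<Rightarrow> ('v \<Rightarrow> 'v \<Rightarrow> 'v) \<Rightarrow> ('v \<Rightarrow> 'v)
     \<Rightarrow> 'v list \<Rightarrow> 'v" where
  "lambda scale V0 V1 mult Q vs =
     (\<Sum>ps \<in> {ps. length ps = length vs \<and> set ps \<subseteq> {0, 1}}.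
        lambda_homog scale mult Q (zip ps (map2 (component V0 V1) ps vs)))"

definition mu ::
  "('k::field \<Rightarrow> 'v::ab_group_add \<Rightarrow> 'v) \<Rightarrow> 'v set \<Rightarrow> 'v set \<Rightarrow> ('v \<Rightarrow> 'v \<Rightarrow> 'v) \<Rightarrow> ('v \<Rightarrow> 'v)
     \<Rightarrow> ('v \<Rightarrow> 'v) \<Rightarrow> 'v list \<Rightarrow> 'v" where
  "mu scale V0 V1 mult d Q vs =
     (if length vs = 1 then d (hd vs)
      else lambda scale V0 V1 mult Q vs - odd_commutator d Q (lambda scale V0 V1 mult Q vs))"

text \<open>
  In the identities, \<open>vs = [v\<^sub>1, \<dots>, v\<^sub>n]\<close> and \<open>ps\<close> is the list of the
  parities. The value of \<open>m\<close> on the empty list is irrelevant.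
\<close>

locale A_infinity_algebra = vector_superspace scale W W0 W1
  for scale :: "'k::field \<Rightarrow> 'v::ab_group_add \<Rightarrow> 'v" and W W0 W1 :: "'v set" +
  fixes m :: "'v list \<Rightarrow> 'v"
  assumes m_closed: "\<And>vs. vs \<noteq> [] \<Longrightarrow> set vs \<subseteq> W \<Longrightarrow> m vs \<in> W"
    and m_add: "\<And>us x y ws. set us \<subseteq> W \<Longrightarrow> x \<in> W \<Longrightarrow> y \<in> W \<Longrightarrow> set ws \<subseteq> W \<Longrightarrow>
                  m (us @ (x + y) # ws) = m (us @ x # ws) + m (us @ y # ws)"
    and m_scale: "\<And>us c x ws. set us \<subseteq> W \<Longrightarrow> x \<in> W \<Longrightarrow> set ws \<subseteq> W \<Longrightarrow>
                  m (us @ scale c x # ws) = scale c (m (us @ x # ws))"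
    and m_parity: "\<And>ps vs. vs \<noteq> [] \<Longrightarrow> list_all2 (\<lambda>p v. v \<in> homog W0 W1 p) ps vs \<Longrightarrow>
                  m vs \<in> homog W0 W1 (sum_list ps + length vs)"
    and higher_associativity:
      "\<And>n ps vs. n \<ge> 1 \<Longrightarrow> length vs = n \<Longrightarrow> list_all2 (\<lambda>p v. v \<in> homog W0 W1 p) ps vs \<Longrightarrow>
         (\<Sum>(k, l) \<in> {(k, l). k + l = n + 1 \<and> k \<ge> 1 \<and> l \<ge> 1}. \<Sum>j = 0..k - 1.
            scale ((-1) ^ (l * sum_list (take j ps) + j * (l - 1) + (k - 1) * l))
              (m (take j vs @ [m (take l (drop j vs))] @ drop (j + l) vs))) = 0"

end

theory Submission
  imports Defs
begin

text \<open>
  Put the suspension signs on \<open>\<lambda>\<^sub>n\<close>, giving \<open>L\<close>, and let \<open>F\<close> be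
  the identity on words of length 1 and \<open>- Q L\<close> on longer ones. With \<open>m(x, y) = \<plusminus> x y\<close>
  the recursion reads \<open>L = m(F \<otimes> F)\<close>, and the suspended operations are \<open>b = P L\<close> with
  \<open>P = 1 - [d, Q]\<close> (and \<open>b = d\<close> in length 1). For the coderivation
  \<open>B\<close> extending \<open>b\<close> one shows \<open>d L + L B = 0\<close> by induction on the word length: for shorter
  words the hypothesis gives \<open>F B - d F = L = m(F \<otimes> F)\<close>, and substituting this into
  \<open>d m(F \<otimes> F) + m(F \<otimes> F) B\<close> leaves the associator of \<open>m\<close>, which vanishes. Since \<open>d\<close> commutes
  with \<open>P\<close>, it follows that \<open>b B = P (d L + L B) = 0\<close>, which is the family of \<open>A\<^sub>\<infinity>\<close> identities.
  All of this takes place on \<open>V\<close>; the subcomplex \<open>W\<close> enters only through closure.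
\<close>

section \<open>Signs and suspended degrees\<close>

definition signed :: "nat \<Rightarrow> 'v::ab_group_add \<Rightarrow> 'v" where
  "signed n v = (if even n then v else - v)"

lemma signed_0 [simp]: "signed n 0 = 0"
  by (simp add: signed_def)

lemma signed_signed: "signed m (signed n v) = signed (m + n) v"
  by (simp add: signed_def)

lemma signed_add: "signed n (v + w) = signed n v + signed n w"
  by (simp add: signed_def)

lemma signed_uminus: "signed n (- v) = - signed n v"
  by (simp add: signed_def)

lemma signed_Suc: "signed (Suc n) v = - signed n v"
  by (simp add: signed_def)

lemma signed_sum: "signed n (sum f A) = (\<Sum>x\<in>A. signed n (f x))"
  by (simp add: signed_def sum_negf)

text \<open>Signs are kept as exponents of \<open>signed\<close>, free of field arithmetic, so that
  comparing two of them becomes a parity check.\<close>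

lemma signed_cong: "even (m + n) \<Longrightarrow> signed m v = signed n v"
  by (simp add: signed_def)

definition parity :: "(nat \<times> 'v) list \<Rightarrow> nat" where
  "parity xs = sum_list (map fst xs)"

text \<open>Parity of the word after suspension: every letter is shifted by one.\<close>

definition deg :: "(nat \<times> 'v) list \<Rightarrow> nat" where
  "deg xs = parity xs + length xs"

lemma parity_simps [simp]:
  "parity [] = 0" "parity (x # xs) = fst x + parity xs"
  "parity (xs @ ys) = parity xs + parity ys"
  by (simp_all add: parity_def)

lemma deg_simps [simp]:
  "deg [] = 0" "deg (x # xs) = fst x + 1 + deg xs" "deg (xs @ ys) = deg xs + deg ys"
  by (simp_all add: deg_def)

text \<open>Exponent of the sign that the suspension isomorphism puts on an operation applied to \<open>xs\<close>.\<close>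

fun susp :: "(nat \<times> 'v) list \<Rightarrow> nat" where
  "susp [] = 0"
| "susp (x # xs) = fst x * length xs + susp xs"

text \<open>A letter contributes its parity once per letter to its right, so each letter of
  \<open>xs\<close> pays \<open>length ys\<close> more times.\<close>

lemma susp_append: "susp (xs @ ys) = susp xs + susp ys + length ys * parity xs"
  by (induction xs) (auto simp: algebra_simps)

section \<open>Subwords and cuts of a word\<close>

definition subwords :: "nat \<Rightarrow> (nat \<times> nat) set" where
  "subwords n = {(j, l). 1 \<le> l \<and> j + l \<le> n}"

lemma finite_subwords [simp]: "finite (subwords n)"
  by (rule finite_subset[of _ "{0..n} \<times> {0..n}"]) (auto simp: subwords_def)

text \<open>Contract the subword at offset \<open>j\<close> of length \<open>l\<close> to one
  letter, then cut after \<open>k\<close> letters. The cut lies before the new letter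
  (\<open>k \<le> j\<close>, same position in the old word) or behind it (old position
  \<open>k + l - 1\<close>). After exchanging the sums one first cuts at \<open>c\<close> and then
  picks a subword of the prefix (\<open>g\<close>) or of the suffix (\<open>f\<close>).\<close>

lemma sum_subwords_splits:
  fixes f g :: "nat \<Rightarrow> nat \<Rightarrow> nat \<Rightarrow> 'v::comm_monoid_add"
  shows "(\<Sum>(j, l)\<in>subwords n. \<Sum>k\<in>{1..<n + 1 - l}. if k \<le> j then f j l k else g j l (k + l - 1))
     = (\<Sum>c\<in>{1..<n}. (\<Sum>(j, l)\<in>subwords c. g j l c) + (\<Sum>(j, l)\<in>subwords (n - c). f (c + j) l c))"
proof -
  \<comment> \<open>The guards let \<open>c\<close> range over all of \<open>{1..<n}\<close>,
    independently of \<open>j\<close> and \<open>l\<close>, so that the sums can be swapped.\<close>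
  have split: "(\<Sum>k\<in>{1..<n + 1 - l}. if k \<le> j then f j l k else g j l (k + l - 1))
      = (\<Sum>c\<in>{1..<n}. if c \<le> j then f j l c else 0) + (\<Sum>c\<in>{1..<n}. if j + l \<le> c then g j l c else 0)"
    if "(j, l) \<in> subwords n" for j l
  proof -
    have jl: "1 \<le> l" "j + l \<le> n" using that by (auto simp: subwords_def)
    have "(\<Sum>k\<in>{1..<n + 1 - l}. if k \<le> j then f j l k else g j l (k + l - 1))
      = (\<Sum>k\<in>{1..j} \<union> {j+1..<n+1-l}. if k \<le> j then f j l k else g j l (k + l - 1))"
      using jl by (intro sum.cong) auto
    also have "\<dots> = (\<Sum>k\<in>{1..j}. f j l k) + (\<Sum>k\<in>{j+1..<n+1-l}. g j l (k + l - 1))"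
      by (subst sum.union_disjoint) (auto intro!: arg_cong2[of _ _ _ _ "(+)"] sum.cong)
    also have "(\<Sum>k\<in>{1..j}. f j l k) = (\<Sum>c\<in>{1..<n}. if c \<le> j then f j l c else 0)"
      using jl by (intro sum.mono_neutral_cong_left) auto
    also have "(\<Sum>k\<in>{j+1..<n+1-l}. g j l (k + l - 1)) = (\<Sum>c\<in>{j+l..<n}. g j l c)"
      using jl by (intro sum.reindex_bij_witness[of _ "\<lambda>c. c + 1 - l" "\<lambda>k. k + l - 1"]) auto
    also have "\<dots> = (\<Sum>c\<in>{1..<n}. if j + l \<le> c then g j l c else 0)"
      using jl by (intro sum.mono_neutral_cong_left) auto
    finally show ?thesis .
  qed
  have "(\<Sum>(j, l)\<in>subwords n. \<Sum>k\<in>{1..<n + 1 - l}. if k \<le> j then f j l k else g j l (k + l - 1))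
      = (\<Sum>(j, l)\<in>subwords n. \<Sum>c\<in>{1..<n}. (if j + l \<le> c then g j l c else 0)
           + (if c \<le> j then f j l c else 0))"
  proof (intro sum.cong refl, clarify)
    fix j l assume "(j, l) \<in> subwords n"
    from split[OF this] show "(\<Sum>k\<in>{1..<n + 1 - l}. if k \<le> j then f j l k else g j l (k + l - 1))
      = (\<Sum>c\<in>{1..<n}. (if j + l \<le> c then g j l c else 0) + (if c \<le> j then f j l c else 0))"
      by (simp only: sum.distrib add.commute)
  qed
  also have "\<dots> = (\<Sum>c\<in>{1..<n}. (\<Sum>(j, l)\<in>subwords n. if j + l \<le> c then g j l c else 0)
           + (\<Sum>(j, l)\<in>subwords n. if c \<le> j then f j l c else 0))"
    by (simp only: case_prod_unfold sum.swap[of _ _ "subwords n"] sum.distrib)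
  also have "\<dots> = (\<Sum>c\<in>{1..<n}. (\<Sum>(j, l)\<in>subwords c. g j l c)
           + (\<Sum>(j, l)\<in>subwords (n - c). f (c + j) l c))"
  proof (rule sum.cong[OF refl])
    fix c assume c: "c \<in> {1..<n}"
    have g: "(\<Sum>(j, l)\<in>subwords n. if j + l \<le> c then g j l c else 0) = (\<Sum>(j, l)\<in>subwords c. g j l c)"
      using c finite_subwords[of n]
      by (intro sum.mono_neutral_cong_right) (auto simp: subwords_def split: if_splits)
    have "(\<Sum>(j, l)\<in>subwords n. if c \<le> j then f j l c else 0)
        = (\<Sum>(j, l)\<in>{(j, l)\<in>subwords n. c \<le> j}. f j l c)"
      by (intro sum.mono_neutral_cong_right) (auto split: if_splits)
    also have "\<dots> = (\<Sum>(j, l)\<in>subwords (n - c). f (c + j) l c)"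
      using c by (intro sum.reindex_bij_witness[of _ "\<lambda>(j, l). (c + j, l)" "\<lambda>(j, l). (j - c, l)"])
        (auto simp: subwords_def)
    finally have f: "(\<Sum>(j, l)\<in>subwords n. if c \<le> j then f j l c else 0)
        = (\<Sum>(j, l)\<in>subwords (n - c). f (c + j) l c)" .
    show "(\<Sum>(j, l)\<in>subwords n. if j + l \<le> c then g j l c else 0)
          + (\<Sum>(j, l)\<in>subwords n. if c \<le> j then f j l c else 0)
        = (\<Sum>(j, l)\<in>subwords c. g j l c) + (\<Sum>(j, l)\<in>subwords (n - c). f (c + j) l c)"
      by (simp only: f g)
  qed
  finally show ?thesis .
qed

section \<open>Homogeneous components\<close>

context vector_superspace
begin

lemma homog_subspace: "subspace (homog V0 V1 p)"
  by (simp add: homog_def subspace_even subspace_odd)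

lemma homog_cong: "even (p + q) \<Longrightarrow> homog V0 V1 p = homog V0 V1 q"
  by (auto simp: homog_def)

lemma scale_sign: "scale ((-1) ^ n) v = signed n v"
  by (simp add: signed_def minus_one_power_iff)

lemma signed_homog: "v \<in> homog V0 V1 p \<Longrightarrow> signed n v \<in> homog V0 V1 p"
  by (simp add: signed_def subspace_neg homog_subspace)

lemma homog_Int_shift: "v \<in> homog V0 V1 p \<Longrightarrow> v \<in> homog V0 V1 (p + 1) \<Longrightarrow> v = 0"
  using even_Int_odd by (auto simp: homog_def split: if_splits)

text \<open>Two candidates for the definite description differ by a vector that is both even and
  odd, hence zero.\<close>

lemma component_eqI:
  assumes "a \<in> homog V0 V1 p" "v - a \<in> homog V0 V1 (p + 1)"
  shows "component V0 V1 p v = a"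
  unfolding component_def
proof (rule the_equality)
  fix b assume b: "b \<in> homog V0 V1 p \<and> v - b \<in> homog V0 V1 (p + 1)"
  have "b - a \<in> homog V0 V1 p"
    using assms b by (intro subspace_diff homog_subspace) auto
  moreover have "b - a \<in> homog V0 V1 (p + 1)"
    using subspace_diff[OF homog_subspace assms(2) conjunct2[OF b]] by simp
  ultimately show "b = a"
    using homog_Int_shift[of "b - a" p] by simp
qed (use assms in simp)

lemma component_homog:
  assumes "v \<in> homog V0 V1 p"
  shows "component V0 V1 q v = (if even (p + q) then v else 0)"
proof (rule component_eqI)
  show "(if even (p + q) then v else 0) \<in> homog V0 V1 q"
    using assms homog_cong[of p q] subspace_0[OF homog_subspace] by auto
  show "v - (if even (p + q) then v else 0) \<in> homog V0 V1 (q + 1)"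
    using assms homog_cong[of p "q + 1"] subspace_0[OF homog_subspace] by auto
qed

lemma component_decomp:
  assumes "v \<in> V"
  shows "component V0 V1 p v \<in> homog V0 V1 p" "v - component V0 V1 p v \<in> homog V0 V1 (p + 1)"
proof -
  obtain a b where ab: "v = a + b" "a \<in> V0" "b \<in> V1"
    using assms carrier_eq by auto
  define c where "c = (if even p then a else b)"
  have "c \<in> homog V0 V1 p" "v - c \<in> homog V0 V1 (p + 1)"
    using ab by (auto simp: c_def homog_def)
  with component_eqI[OF this]
  show "component V0 V1 p v \<in> homog V0 V1 p" "v - component V0 V1 p v \<in> homog V0 V1 (p + 1)"
    by auto
qed

lemma component_add:
  assumes "v \<in> V" "w \<in> V"
  shows "component V0 V1 p (v + w) = component V0 V1 p v + component V0 V1 p w"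
proof (rule component_eqI)
  show "component V0 V1 p v + component V0 V1 p w \<in> homog V0 V1 p"
    using assms by (intro subspace_add homog_subspace component_decomp)
  have "(v - component V0 V1 p v) + (w - component V0 V1 p w) \<in> homog V0 V1 (p + 1)"
    using assms by (intro subspace_add homog_subspace component_decomp)
  then show "v + w - (component V0 V1 p v + component V0 V1 p w) \<in> homog V0 V1 (p + 1)"
    by (simp add: algebra_simps)
qed

lemma component_scale:
  assumes "v \<in> V"
  shows "component V0 V1 p (scale c v) = scale c (component V0 V1 p v)"
proof (rule component_eqI)
  show "scale c (component V0 V1 p v) \<in> homog V0 V1 p"
    using assms by (intro subspace_scale homog_subspace component_decomp)
  have "scale c (v - component V0 V1 p v) \<in> homog V0 V1 (p + 1)"
    using assms by (intro subspace_scale homog_subspace component_decomp)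
  then show "scale c v - scale c (component V0 V1 p v) \<in> homog V0 V1 (p + 1)"
    by (simp add: scale_right_diff_distrib)
qed

end

section \<open>The operators \<open>d\<close>, \<open>Q\<close> and \<open>P\<close>\<close>

locale homotopy_transfer = diff_assoc_superalgebra scale V0 V1 mult d
  for scale :: "'k::field \<Rightarrow> 'v::ab_group_add \<Rightarrow> 'v" and V0 V1 :: "'v set"
    and mult :: "'v \<Rightarrow> 'v \<Rightarrow> 'v" and d :: "'v \<Rightarrow> 'v" +
  fixes Q :: "'v \<Rightarrow> 'v"
  assumes Q_odd: "odd_operator scale V0 V1 Q"
begin

abbreviation lin :: "('v \<Rightarrow> 'v) \<Rightarrow> bool" where
  "lin \<equiv> Vector_Spaces.linear scale scale"

abbreviation hom :: "nat \<Rightarrow> 'v set" where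
  "hom \<equiv> homog V0 V1"

abbreviation lam :: "(nat \<times> 'v) list \<Rightarrow> 'v" where
  "lam \<equiv> lambda_homog scale mult Q"

abbreviation homogs :: "(nat \<times> 'v) list \<Rightarrow> bool" where
  "homogs xs \<equiv> list_all (\<lambda>(p, v). v \<in> hom p) xs"

definition P :: "'v \<Rightarrow> 'v" where
  "P v = v - odd_commutator d Q v"

lemma lin_iff: "lin f \<longleftrightarrow> (\<forall>x y. f (x + y) = f x + f y) \<and> (\<forall>c x. f (scale c x) = scale c (f x))"
  using vector_space_axioms module_axioms
  by (auto simp: Vector_Spaces.linear_def module_hom_def module_hom_axioms_def)

lemma
  assumes "lin f"
  shows lin_add: "f (x + y) = f x + f y"
    and lin_scale: "f (scale c x) = scale c (f x)"
    and lin_0: "f 0 = 0"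
    and lin_neg: "f (- x) = - f x"
    and lin_diff: "f (x - y) = f x - f y"
    and lin_sum: "f (sum g A) = (\<Sum>a\<in>A. f (g a))"
    and lin_signed: "f (signed n x) = signed n (f x)"
proof -
  interpret module_hom scale scale f
    using assms by (simp add: Vector_Spaces.linear_def)
  show "f (x + y) = f x + f y" "f (scale c x) = scale c (f x)" "f 0 = 0" "f (- x) = - f x"
    "f (x - y) = f x - f y" "f (sum g A) = (\<Sum>a\<in>A. f (g a))"
    by (simp_all add: add scale zero neg diff sum)
  show "f (signed n x) = signed n (f x)" by (simp add: signed_def neg)
qed

lemma lin_comp: "lin f \<Longrightarrow> lin g \<Longrightarrow> lin (\<lambda>x. f (g x))"
  by (simp add: lin_iff)

lemma lin_setsum: "(\<And>a. a \<in> A \<Longrightarrow> lin (f a)) \<Longrightarrow> lin (\<lambda>x. \<Sum>a\<in>A. f a x)"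
  by (simp add: lin_iff sum.distrib scale_sum_right)

lemma lin_signedI: "lin f \<Longrightarrow> lin (\<lambda>x. signed n (f x))"
  by (simp add: lin_iff signed_add signed_def)

lemma lin_d: "lin d" and lin_Q: "lin Q"
  using d_odd Q_odd by (simp_all add: odd_operator_def)

lemma d_hom: "v \<in> hom p \<Longrightarrow> d v \<in> hom (p + 1)" and Q_hom: "v \<in> hom p \<Longrightarrow> Q v \<in> hom (p + 1)"
  using d_odd Q_odd by (simp_all add: odd_operator_def)

lemma lin_P: "lin P"
  using lin_d lin_Q
  by (simp add: lin_iff P_def odd_commutator_def algebra_simps scale_right_distrib scale_right_diff_distrib)

text \<open>Since \<open>d\<close> squares to zero, both sides are
  \<open>d v - d (Q (d v))\<close>.\<close>

lemma d_P: "d (P v) = P (d v)"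
  by (simp add: P_def odd_commutator_def lin_diff[OF lin_d] lin_add[OF lin_d] d_d lin_0[OF lin_Q])

lemma P_hom: "v \<in> hom p \<Longrightarrow> P v \<in> hom p"
  unfolding P_def odd_commutator_def
  using d_hom[OF Q_hom, of v p] Q_hom[OF d_hom, of v p] homog_cong[of "p + 1 + 1" p]
  by (intro subspace_diff subspace_add homog_subspace) auto

section \<open>The recursion as a sum over cuts\<close>

text \<open>With the convention \<open>Q\<lambda>\<^sub>1 = -id\<close> the three parts of the recursion for \<open>\<lambda>\<^sub>n\<close> become one sum.\<close>

definition qlam :: "(nat \<times> 'v) list \<Rightarrow> 'v" where
  "qlam xs = (if length xs = 1 then - snd (hd xs) else Q (lam xs))"

lemma lam_short: "length xs < 2 \<Longrightarrow> lam xs = 0"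
  by (simp add: lambda_homog.simps)

text \<open>The outer products of the recursion are the terms \<open>k = 1\<close> and
  \<open>k = length xs - 1\<close>, each with a single-letter factor whose minus sign corrects the
  exponent. In length 2 both factors are single letters and their signs cancel.\<close>

lemma lam_rec:
  "lam xs = (\<Sum>k\<in>{1..<length xs}. signed (k + 1 + (length xs - k - 1) * parity (take k xs))
     (mult (qlam (take k xs)) (qlam (drop k xs))))"
proof -
  define n where "n = length xs"
  define t where "t k = signed (k + 1 + (n - k - 1) * parity (take k xs))
     (mult (qlam (take k xs)) (qlam (drop k xs)))" for k
  consider "n < 2" | "n = 2" | "n \<ge> 3" by linarith
  then have "lam xs = sum t {1..<n}"
  proof cases
    case 1
    then show ?thesis by (simp add: lam_short n_def)
  next
    case 2
    then obtain x y where xs: "xs = [x, y]"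
      by (auto simp: n_def numeral_2_eq_2 length_Suc_conv)
    then show ?thesis
      by (simp add: n_def lambda_homog.simps t_def qlam_def signed_def
          lin_neg[OF mult_linear_left] lin_neg[OF mult_linear_right])
  next
    case 3
    then have "xs \<noteq> []" by (auto simp: n_def)
    have drop_last: "drop (n - 1) xs = [last xs]"
      using \<open>xs \<noteq> []\<close> unfolding n_def
      by (metis append_butlast_last_id append_eq_conv_conj length_butlast)
    have "n - 1 \<noteq> 1" using 3 by simp
    then have tn: "t (n - 1) = scale ((-1) ^ (n - 1)) (mult (Q (lam (butlast xs))) (snd (last xs)))"
      using 3 \<open>xs \<noteq> []\<close> unfolding t_def drop_last
      by (simp add: qlam_def scale_sign butlast_conv_take n_def lin_neg[OF mult_linear_right]
          signed_def)
    have t1: "t 1 = - scale ((-1) ^ (n * fst (hd xs))) (mult (snd (hd xs)) (Q (lam (tl xs))))"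
      using 3 \<open>xs \<noteq> []\<close>
      by (cases xs) (auto simp: t_def qlam_def scale_sign n_def lin_neg[OF mult_linear_left]
          signed_def)
    have tk: "scale ((-1) ^ (k + (n - k - 1) * sum_list (map fst (take k xs))))
        (mult (Q (lam (take k xs))) (Q (lam (drop k xs)))) = - t k" if "2 \<le> k" "k + 2 \<le> n" for k
    proof -
      have "length xs - k \<noteq> 1" "k \<noteq> 1" using that by (auto simp: n_def)
      then show ?thesis
        using that by (simp add: t_def qlam_def scale_sign parity_def signed_Suc n_def)
    qed
    \<comment> \<open>\<open>l \<ge> 2\<close> means \<open>k \<le> n - 2\<close>, hence the
      exclusive bound \<open>n - 1\<close>.\<close>
    have "(\<Sum>(k, l) \<in> {(k, l). k + l = n \<and> k \<ge> 2 \<and> l \<ge> 2}.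
           scale ((-1) ^ (k + (l - 1) * sum_list (map fst (take k xs))))
             (mult (Q (lam (take k xs))) (Q (lam (drop k xs)))))
        = (\<Sum>k\<in>{2..<n - 1}. - t k)"
      by (rule sum.reindex_bij_witness[of _ "\<lambda>k. (k, n - k)" fst])
        (auto simp flip: tk)
    then have "lam xs = t (n - 1) + t 1 + sum t {2..<n - 1}"
      using 3 by (subst lambda_homog.simps) (simp add: tn t1 sum_negf del: One_nat_def flip: n_def)
    also have "\<dots> = sum t {1..<n}"
    proof -
      have "{1..<n} = insert 1 (insert (n - 1) {2..<n - 1})" using 3 by auto
      then show ?thesis using 3 by (simp add: add.assoc add.left_commute)
    qed
    finally show ?thesis .
  qed
  then show ?thesis by (simp add: t_def n_def)
qed

text \<open>Signs see only the labels, and in each product of \<open>lam_rec\<close> exactly one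
  factor contains the slot. The label \<open>p\<close> stays fixed while \<open>x\<close> runs
  through all vectors, homogeneous or not.\<close>

lemma lin_lam: "lin (\<lambda>x. lam (us @ (p, x) # ws))"
proof (induction "length us + length ws" arbitrary: us ws rule: less_induct)
  case less
  have q: "lin (\<lambda>x. qlam (us' @ (p, x) # ws'))"
    if "length us' + length ws' < length us + length ws" for us' ws'
  proof (cases "us' = [] \<and> ws' = []")
    case True
    then show ?thesis by (simp add: qlam_def lin_iff)
  next
    case False
    then have "length (us' @ (p, x) # ws') \<noteq> 1" for x by auto
    then have "(\<lambda>x. qlam (us' @ (p, x) # ws')) = (\<lambda>x. Q (lam (us' @ (p, x) # ws')))"
      by (auto simp: qlam_def)
    then show ?thesis using lin_comp[OF lin_Q less[OF that]] by simp
  qed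
  show ?case
    unfolding lam_rec[of "us @ _"]
  proof (simp only: length_append length_Cons, rule lin_setsum)
    fix k assume k: "k \<in> {1..<length us + Suc (length ws)}"
    define m where "m = parity (take k (us @ (p, 0) # ws))"
    have par: "parity (take k (us @ (p, x) # ws)) = m" for x
      by (auto simp: take_Cons' parity_def m_def)
    show "lin (\<lambda>x. signed (k + 1 + (length us + Suc (length ws) - k - 1)
        * parity (take k (us @ (p, x) # ws)))
        (mult (qlam (take k (us @ (p, x) # ws))) (qlam (drop k (us @ (p, x) # ws)))))"
      unfolding par
    proof (rule lin_signedI, cases "k \<le> length us")
      case True
      have "lin (\<lambda>x. mult (qlam (take k us)) (qlam (drop k us @ (p, x) # ws)))"
        using k True by (intro lin_comp[OF mult_linear_right] q) auto
      then show "lin (\<lambda>x. mult (qlam (take k (us @ (p, x) # ws))) (qlam (drop k (us @ (p, x) # ws))))"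
        using True by simp
    next
      case False
      then obtain i where i: "k = length us + Suc i"
        by (metis add_Suc_right less_imp_Suc_add not_le)
      have "lin (\<lambda>x. mult (qlam (us @ (p, x) # take i ws)) (qlam (drop i ws)))"
        using k i by (intro lin_comp[OF mult_linear_left] q) auto
      then show "lin (\<lambda>x. mult (qlam (take k (us @ (p, x) # ws))) (qlam (drop k (us @ (p, x) # ws))))"
        using i by simp
    qed
  qed
qed

text \<open>Labels may be any naturals, but \<open>lambda\<close> sums over the labels 0 and 1; this
  normalization connects the two.\<close>

definition reduce :: "(nat \<times> 'v) list \<Rightarrow> (nat \<times> 'v) list" where
  "reduce = map (\<lambda>(p, v). (p mod 2, v))"

lemma even_parity_reduce: "even (parity (reduce xs)) = even (parity xs)"
  by (induction xs) (auto simp: reduce_def parity_def)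

text \<open>Labels enter the recursion only through exponents of signs.\<close>

lemma lam_reduce: "lam (reduce xs) = lam xs"
proof (induction "length xs" arbitrary: xs rule: less_induct)
  case less
  have q: "qlam (reduce ys) = qlam ys" if "length ys < length xs" for ys
    using less[OF that] by (cases ys) (auto simp: qlam_def reduce_def)
  have len: "length (reduce xs) = length xs" by (simp add: reduce_def)
  have "signed (k + 1 + (length xs - k - 1) * parity (take k (reduce xs)))
        (mult (qlam (take k (reduce xs))) (qlam (drop k (reduce xs))))
      = signed (k + 1 + (length xs - k - 1) * parity (take k xs))
        (mult (qlam (take k xs)) (qlam (drop k xs)))" if "k \<in> {1..<length xs}" for k
  proof -
    have "take k (reduce xs) = reduce (take k xs)" "drop k (reduce xs) = reduce (drop k xs)"
      by (simp_all add: reduce_def take_map drop_map)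
    then show ?thesis
      using that
      by (auto simp: q even_parity_reduce intro!: arg_cong2[of _ _ _ _ mult] signed_cong)
  qed
  then show ?case by (subst (1 2) lam_rec) (simp only: len cong: sum.cong)
qed

section \<open>The suspended maps \<open>L\<close> and \<open>F\<close>\<close>

definition L :: "(nat \<times> 'v) list \<Rightarrow> 'v" where
  "L xs = signed (susp xs) (lam xs)"

definition F :: "(nat \<times> 'v) list \<Rightarrow> 'v" where
  "F xs = (if length xs = 1 then snd (hd xs) else - Q (L xs))"

lemma L_short: "length xs < 2 \<Longrightarrow> L xs = 0"
  by (simp add: L_def lam_short)

lemma F_eq: "F xs = - signed (susp xs) (qlam xs)"
proof (cases "length xs = 1")
  case True
  then obtain x where "xs = [x]" by (auto simp: length_Suc_conv)
  then show ?thesis by (simp add: F_def qlam_def signed_def)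
next
  case False
  then show ?thesis by (simp add: F_def qlam_def L_def lin_signed[OF lin_Q])
qed

text \<open>Modulo 2, the cross term of \<open>susp_append\<close> reduces the exponent in
  \<open>lam_rec\<close> to \<open>deg (take k xs) + 1\<close>. The suspension signs of the two
  pieces go into the factors \<open>F\<close>, whose minus signs from \<open>F_eq\<close>
  cancel.\<close>

lemma L_rec:
  "L xs = (\<Sum>k\<in>{1..<length xs}. signed (deg (take k xs) + 1) (mult (F (take k xs)) (F (drop k xs))))"
proof -
  have "signed (susp xs) (signed (k + 1 + (length xs - k - 1) * parity (take k xs))
       (mult (qlam (take k xs)) (qlam (drop k xs))))
      = signed (deg (take k xs) + 1) (mult (F (take k xs)) (F (drop k xs)))"
    if k: "k \<in> {1..<length xs}" for k
  proof -
    obtain l where l: "length xs = k + Suc l"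
      using k by (metis add_Suc_right atLeastLessThan_iff less_imp_Suc_add)
    have "susp xs = susp (take k xs) + susp (drop k xs) + Suc l * parity (take k xs)"
      using susp_append[of "take k xs" "drop k xs"] l by simp
    moreover have "deg (take k xs) = parity (take k xs) + k"
      using k by (simp add: deg_def)
    ultimately show ?thesis
      using l by (simp add: F_eq lin_neg[OF mult_linear_left] lin_neg[OF mult_linear_right]
          lin_signed[OF mult_linear_left] lin_signed[OF mult_linear_right] signed_signed signed_uminus)
        (auto intro!: signed_cong)
  qed
  then show ?thesis
    by (simp only: L_def lam_rec[of xs] signed_sum cong: sum.cong)
qed

lemma homogs_take_drop: "homogs xs \<Longrightarrow> homogs (take k xs) \<and> homogs (drop k xs)"
  by (auto simp: list_all_iff dest: in_set_takeD in_set_dropD)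

text \<open>Stated relative to \<open>L\<close> so that it serves both inside the induction of
  \<open>L_hom\<close> and after it.\<close>

lemma F_hom_if_L_hom: "(length xs \<noteq> 1 \<Longrightarrow> L xs \<in> hom (deg xs)) \<Longrightarrow> homogs xs \<Longrightarrow> F xs \<in> hom (deg xs + 1)"
proof (cases "length xs = 1")
  case True
  assume "homogs xs"
  with True obtain p v where "xs = [(p, v)]" "v \<in> hom p"
    by (cases xs) auto
  then show ?thesis
    using homog_cong[of p "p + 1 + 1"] by (simp add: F_def)
next
  case False
  assume "length xs \<noteq> 1 \<Longrightarrow> L xs \<in> hom (deg xs)"
  then show ?thesis
    using False Q_hom subspace_neg[OF homog_subspace] by (simp add: F_def)
qed

text \<open>Values are not suspended, so parity \<open>deg xs\<close> makes \<open>L\<close> odd as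
  a suspended map, while \<open>F\<close>, with values of parity \<open>deg xs + 1\<close>, is even;
  a product of two values of \<open>F\<close> gains 2.\<close>

lemma L_hom: "homogs xs \<Longrightarrow> L xs \<in> hom (deg xs)"
proof (induction "length xs" arbitrary: xs rule: less_induct)
  case less
  have F: "F ys \<in> hom (deg ys + 1)" if "length ys < length xs" "homogs ys" for ys
    using F_hom_if_L_hom less that by blast
  show ?case
  proof (subst L_rec, rule subspace_sum[OF homog_subspace], rule signed_homog)
    fix k assume k: "k \<in> {1..<length xs}"
    have "deg xs = deg (take k xs) + deg (drop k xs)"
      by (metis append_take_drop_id deg_simps(3))
    moreover have "mult (F (take k xs)) (F (drop k xs)) \<in> hom ((deg (take k xs) + 1) + (deg (drop k xs) + 1))"
      using k homogs_take_drop[OF less(2)] by (intro mult_even F) auto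
    ultimately show "mult (F (take k xs)) (F (drop k xs)) \<in> hom (deg xs)"
      using homog_cong[of "deg xs" "(deg (take k xs) + 1) + (deg (drop k xs) + 1)"] by simp
  qed
qed

lemma F_hom: "homogs xs \<Longrightarrow> F xs \<in> hom (deg xs + 1)"
  using F_hom_if_L_hom L_hom by blast

section \<open>The operations \<open>b\<close> and the coderivation they generate\<close>

definition b :: "(nat \<times> 'v) list \<Rightarrow> 'v" where
  "b xs = (if length xs = 1 then d (snd (hd xs)) else P (L xs))"

lemma b_hom: "xs \<noteq> [] \<Longrightarrow> homogs xs \<Longrightarrow> b xs \<in> hom (deg xs)"
  using L_hom[of xs] P_hom d_hom by (cases xs) (auto simp: b_def)

text \<open>By \<open>b_hom\<close>, the label of the new letter is the parity of its vector when
  the contracted subword is nonempty and homogeneous.\<close>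

definition ins :: "nat \<Rightarrow> nat \<Rightarrow> (nat \<times> 'v) list \<Rightarrow> (nat \<times> 'v) list" where
  "ins j l xs = take j xs @ [(deg (take l (drop j xs)), b (take l (drop j xs)))] @ drop (j + l) xs"

text \<open>Composition of \<open>f\<close> with the coderivation of the tensor coalgebra that extends \<open>b\<close>.\<close>

definition bhat :: "((nat \<times> 'v) list \<Rightarrow> 'v) \<Rightarrow> (nat \<times> 'v) list \<Rightarrow> 'v" where
  "bhat f xs = (\<Sum>(j, l)\<in>subwords (length xs). signed (deg (take j xs)) (f (ins j l xs)))"

lemma length_ins: "j + l \<le> length xs \<Longrightarrow> length (ins j l xs) = length xs + 1 - l"
  by (simp add: ins_def)

text \<open>The new letter counts \<open>deg\<close> of what it replaces plus one for its own
  suspension: the coderivation is odd.\<close>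

lemma deg_ins: "deg (ins j l xs) = deg xs + 1"
proof -
  have "xs = take j xs @ take l (drop j xs) @ drop (j + l) xs"
    by (metis append_take_drop_id drop_drop add.commute)
  then have "deg xs = deg (take j xs) + deg (take l (drop j xs)) + deg (drop (j + l) xs)"
    by (metis add.assoc deg_simps(3))
  then show ?thesis by (simp add: ins_def)
qed

lemma ins_split_left:
  assumes "c \<le> j" "j + l \<le> length xs"
  shows "take c (ins j l xs) = take c xs" "drop c (ins j l xs) = ins (j - c) l (drop c xs)"
  using assms by (auto simp: ins_def min_def drop_take add.commute)

text \<open>Since \<open>l\<close> letters become one, a cut at \<open>c\<close> behind the subword
  moves to \<open>c + 1 - l\<close>.\<close>

lemma ins_split_right:
  assumes "j + l \<le> c" "c \<le> length xs"
  shows "take (c + 1 - l) (ins j l xs) = ins j l (take c xs)" "drop (c + 1 - l) (ins j l xs) = drop c xs"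
proof -
  obtain i where i: "c = j + l + i"
    using assms(1) by (auto simp: le_iff_add)
  show "take (c + 1 - l) (ins j l xs) = ins j l (take c xs)"
    using assms by (simp add: ins_def i min_def drop_take)
  show "drop (c + 1 - l) (ins j l xs) = drop c xs"
    using assms by (simp add: ins_def i min_def add.commute)
qed

text \<open>Expand by \<open>L_rec\<close> and regroup by cuts of the old word. If \<open>b\<close>
  acts in the prefix, \<open>deg_ins\<close> cancels the \<open>+ 1\<close> in the sign of
  \<open>L_rec\<close>; if it acts in the suffix, the degree of the prefix occurs twice and that
  \<open>+ 1\<close> survives as a minus sign.\<close>

lemma bhat_L:
  "bhat L xs = (\<Sum>c\<in>{1..<length xs}.
     signed (deg (take c xs)) (mult (bhat F (take c xs)) (F (drop c xs)))
     - mult (F (take c xs)) (bhat F (drop c xs)))"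
proof -
  define n where "n = length xs"
  \<comment> \<open>\<open>f\<close> and \<open>g\<close> are the terms with the contracted subword
    after and before the cut \<open>c\<close> of the old word.\<close>
  define f where "f j l c = signed (deg (take j xs)) (signed (deg (take c xs) + 1)
    (mult (F (take c xs)) (F (ins (j - c) l (drop c xs)))))" for j l c
  define g where "g j l c = signed (deg (take j xs)) (signed (deg (take c xs))
    (mult (F (ins j l (take c xs))) (F (drop c xs))))" for j l c
  have "bhat L xs = (\<Sum>(j, l)\<in>subwords n. \<Sum>k\<in>{1..<n + 1 - l}.
      if k \<le> j then f j l k else g j l (k + l - 1))"
    unfolding bhat_def n_def[symmetric]
  proof (rule sum.cong[OF refl], clarify)
    fix j l assume "(j, l) \<in> subwords n"
    then have jl: "1 \<le> l" "j + l \<le> length xs" by (auto simp: subwords_def n_def)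
    have "signed (deg (take j xs)) (signed (deg (take k (ins j l xs)) + 1)
          (mult (F (take k (ins j l xs))) (F (drop k (ins j l xs)))))
        = (if k \<le> j then f j l k else g j l (k + l - 1))" if k: "k \<in> {1..<n + 1 - l}" for k
    proof (cases "k \<le> j")
      case True
      then show ?thesis using jl by (simp add: f_def ins_split_left)
    next
      case False
      define c where "c = k + l - 1"
      have c: "j + l \<le> c" "c \<le> length xs" "k = c + 1 - l"
        using False k jl by (auto simp: c_def n_def)
      show ?thesis
        unfolding c_def[symmetric] using False jl c(1,2)
        by (simp only: g_def c(3) ins_split_right deg_ins if_False)
          (auto intro!: arg_cong[of _ _ "signed (deg (take j xs))"] signed_cong)
    qed
    then show "signed (deg (take j xs)) (L (ins j l xs)) = (\<Sum>k\<in>{1..<n + 1 - l}.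
      if k \<le> j then f j l k else g j l (k + l - 1))"
      using jl by (simp only: L_rec[of "ins j l xs"] signed_sum length_ins n_def cong: sum.cong)
  qed
  also have "\<dots> = (\<Sum>c\<in>{1..<n}. (\<Sum>(j, l)\<in>subwords c. g j l c)
      + (\<Sum>(j, l)\<in>subwords (n - c). f (c + j) l c))"
    by (rule sum_subwords_splits)
  also have "\<dots> = (\<Sum>c\<in>{1..<n}. signed (deg (take c xs)) (mult (bhat F (take c xs)) (F (drop c xs)))
     - mult (F (take c xs)) (bhat F (drop c xs)))"
  proof (rule sum.cong[OF refl])
    fix c assume c: "c \<in> {1..<n}"
    have g: "(\<Sum>(j, l)\<in>subwords c. g j l c)
        = signed (deg (take c xs)) (mult (bhat F (take c xs)) (F (drop c xs)))"
      unfolding bhat_def lin_sum[OF mult_linear_left] signed_sum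
    proof (rule sum.cong)
      show "subwords c = subwords (length (take c xs))" using c by (simp add: n_def)
      fix jl assume "jl \<in> subwords (length (take c xs))"
      then have "min (fst jl) c = fst jl" by (auto simp: subwords_def)
      then show "(case jl of (j, l) \<Rightarrow> g j l c) = signed (deg (take c xs))
        (mult (case jl of (j, l) \<Rightarrow> signed (deg (take j (take c xs))) (F (ins j l (take c xs)))) (F (drop c xs)))"
        by (simp add: case_prod_unfold g_def lin_signed[OF mult_linear_left] signed_signed add.commute)
    qed
    have f: "(\<Sum>(j, l)\<in>subwords (n - c). f (c + j) l c) = - mult (F (take c xs)) (bhat F (drop c xs))"
      unfolding bhat_def lin_sum[OF mult_linear_right] sum_negf[symmetric]
    proof (rule sum.cong)
      show "subwords (n - c) = subwords (length (drop c xs))" by (simp add: n_def)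
      fix jl assume "jl \<in> subwords (length (drop c xs))"
      have "deg (take (c + fst jl) xs) = deg (take c xs) + deg (take (fst jl) (drop c xs))"
        by (simp add: take_add)
      then show "(case jl of (j, l) \<Rightarrow> f (c + j) l c) = - mult (F (take c xs))
        (case jl of (j, l) \<Rightarrow> signed (deg (take j (drop c xs))) (F (ins j l (drop c xs))))"
        by (simp add: case_prod_unfold f_def lin_signed[OF mult_linear_right] signed_signed signed_Suc signed_uminus)
          (auto intro!: signed_cong)
    qed
    show "(\<Sum>(j, l)\<in>subwords c. g j l c) + (\<Sum>(j, l)\<in>subwords (n - c). f (c + j) l c)
        = signed (deg (take c xs)) (mult (bhat F (take c xs)) (F (drop c xs)))
          - mult (F (take c xs)) (bhat F (drop c xs))"
      by (simp only: f g diff_conv_add_uminus)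
  qed
  finally show ?thesis by (simp only: n_def)
qed

text \<open>\<open>F (take c xs)\<close> has parity \<open>deg (take c xs) + 1\<close>, so the
  Leibniz sign cancels the sign of \<open>L_rec\<close> where \<open>d\<close> hits the second
  factor.\<close>

lemma d_L:
  assumes "homogs xs"
  shows "d (L xs) = (\<Sum>c\<in>{1..<length xs}. mult (F (take c xs)) (d (F (drop c xs)))
     - signed (deg (take c xs)) (mult (d (F (take c xs))) (F (drop c xs))))"
  unfolding L_rec[of xs] lin_sum[OF lin_d]
proof (rule sum.cong[OF refl])
  fix c
  have "d (mult (F (take c xs)) (F (drop c xs))) = mult (d (F (take c xs))) (F (drop c xs))
      + signed (deg (take c xs) + 1) (mult (F (take c xs)) (d (F (drop c xs))))"
    using d_mult[OF F_hom F_hom] homogs_take_drop[OF assms] by (simp only: scale_sign)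
  then show "d (signed (deg (take c xs) + 1) (mult (F (take c xs)) (F (drop c xs))))
      = mult (F (take c xs)) (d (F (drop c xs)))
        - signed (deg (take c xs)) (mult (d (F (take c xs))) (F (drop c xs)))"
    by (simp only: lin_signed[OF lin_d]) (simp add: signed_def)
qed

text \<open>Coassociativity of splitting, together with the associativity of \<open>mult\<close>.\<close>

lemma L_assoc:
  "(\<Sum>c\<in>{1..<length xs}. signed (deg (take c xs)) (mult (L (take c xs)) (F (drop c xs))))
     = (\<Sum>c\<in>{1..<length xs}. mult (F (take c xs)) (L (drop c xs)))"
proof -
  define n where "n = length xs"
  \<comment> \<open>Both sides range over cuts of \<open>xs\<close> into three nonempty words; in
    \<open>h a c\<close> the first two have lengths \<open>a\<close> and \<open>c\<close>.\<close>
  define h where "h a c = signed (deg (take c (drop a xs)) + 1) (mult (F (take a xs))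
     (mult (F (take c (drop a xs))) (F (drop (a + c) xs))))" for a c
  have "(\<Sum>c\<in>{1..<n}. signed (deg (take c xs)) (mult (L (take c xs)) (F (drop c xs))))
      = (\<Sum>c\<in>{1..<n}. \<Sum>a\<in>{1..<c}. h a (c - a))"
  proof (rule sum.cong[OF refl])
    fix c assume c: "c \<in> {1..<n}"
    then have len: "length (take c xs) = c" by (simp add: n_def)
    show "signed (deg (take c xs)) (mult (L (take c xs)) (F (drop c xs))) = (\<Sum>a\<in>{1..<c}. h a (c - a))"
      unfolding L_rec[of "take c xs"] lin_sum[OF mult_linear_left] signed_sum len
    proof (rule sum.cong[OF refl])
      fix a assume a: "a \<in> {1..<c}"
      have "take c xs = take a xs @ take (c - a) (drop a xs)"
        using a take_add[of a "c - a" xs] by simp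
      then have "deg (take c xs) = deg (take a xs) + deg (take (c - a) (drop a xs))"
        by simp
      then show "signed (deg (take c xs)) (mult (signed (deg (take a (take c xs)) + 1)
          (mult (F (take a (take c xs))) (F (drop a (take c xs))))) (F (drop c xs))) = h a (c - a)"
        using a by (simp add: h_def lin_signed[OF mult_linear_left] signed_signed mult_assoc
            drop_take min_def) (auto intro!: signed_cong)
    qed
  qed
  also have "\<dots> = (\<Sum>(c, a)\<in>(SIGMA c:{1..<n}. {1..<c}). h a (c - a))"
    by (simp add: sum.Sigma)
  also have "\<dots> = (\<Sum>(a, c)\<in>(SIGMA a:{1..<n}. {1..<n - a}). h a c)"
    by (rule sum.reindex_bij_witness[of _ "\<lambda>(a, c). (a + c, a)" "\<lambda>(c, a). (a, c - a)"]) auto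
  also have "\<dots> = (\<Sum>a\<in>{1..<n}. \<Sum>c\<in>{1..<n - a}. h a c)"
    by (simp add: sum.Sigma)
  also have "\<dots> = (\<Sum>a\<in>{1..<n}. mult (F (take a xs)) (L (drop a xs)))"
  proof (rule sum.cong[OF refl])
    fix a
    have len: "length (drop a xs) = n - a" by (simp add: n_def)
    show "(\<Sum>c\<in>{1..<n - a}. h a c) = mult (F (take a xs)) (L (drop a xs))"
      unfolding L_rec[of "drop a xs"] lin_sum[OF mult_linear_right] len
      by (rule sum.cong[OF refl])
        (simp add: h_def lin_signed[OF mult_linear_right] add.commute)
  qed
  finally show ?thesis by (simp only: n_def)
qed

section \<open>Vanishing of the squared coderivation\<close>

lemma ins_whole: "ins 0 (length xs) xs = [(deg xs, b xs)]"
  by (simp add: ins_def)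

lemma bhat_split_whole:
  assumes "xs \<noteq> []"
  shows "bhat f xs = f [(deg xs, b xs)] + (\<Sum>(j, l)\<in>subwords (length xs) - {(0, length xs)}.
     signed (deg (take j xs)) (f (ins j l xs)))"
proof -
  have "(0, length xs) \<in> subwords (length xs)"
    using assms by (auto simp: subwords_def Suc_le_eq)
  then show ?thesis
    unfolding bhat_def by (subst sum.remove) (auto simp: ins_whole signed_def)
qed

text \<open>\<open>F\<close> and \<open>b\<close> are linear in \<open>L\<close> on longer words and
  exceptional on single letters. Only contracting the whole word yields a single letter, so that
  term is split off; \<open>L\<close> vanishes there, and the other terms assemble to
  \<open>h (bhat L xs)\<close>.\<close>

lemma bhat_linear_cong:
  assumes "xs \<noteq> []" "lin h" "\<And>ys. length ys \<ge> 2 \<Longrightarrow> f ys = h (L ys)"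
  shows "bhat f xs = f [(deg xs, b xs)] + h (bhat L xs)"
proof -
  have "f (ins (fst s) (snd s) xs) = h (L (ins (fst s) (snd s) xs))"
    if "s \<in> subwords (length xs) - {(0, length xs)}" for s
    using that by (intro assms(3)) (auto simp: subwords_def length_ins)
  then have "(\<Sum>(j, l)\<in>subwords (length xs) - {(0, length xs)}. signed (deg (take j xs)) (f (ins j l xs)))
      = (\<Sum>(j, l)\<in>subwords (length xs) - {(0, length xs)}. signed (deg (take j xs)) (h (L (ins j l xs))))"
    by (simp add: case_prod_unfold)
  then show ?thesis
    using assms(1) by (simp add: bhat_split_whole L_short lin_sum[OF assms(2)] lin_signed[OF assms(2)]
        case_prod_unfold)
qed

lemma bhat_F: "xs \<noteq> [] \<Longrightarrow> bhat F xs = b xs - Q (bhat L xs)"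
  by (subst bhat_linear_cong[of _ "\<lambda>x. - Q x"])
    (use lin_Q in \<open>auto simp: F_def lin_iff\<close>)

text \<open>On longer words \<open>bhat F xs\<close> is \<open>P (L xs) + Q (d (L xs))\<close>, that
  is \<open>L xs - d (Q (L xs))\<close>, and \<open>d (F xs)\<close> is
  \<open>- d (Q (L xs))\<close>. On a single letter both sides are 0.\<close>

lemma d_F:
  assumes "xs \<noteq> []" "d (L xs) + bhat L xs = 0"
  shows "bhat F xs - d (F xs) = L xs"
proof (cases "length xs = 1")
  case True
  have "bhat L xs = 0" using assms(2) True by (simp add: L_short lin_0[OF lin_d])
  then show ?thesis
    using True assms(1) by (simp add: bhat_F F_def b_def L_short lin_0[OF lin_Q])
next
  case False
  have "bhat L xs = - d (L xs)" using assms(2) by (simp add: add_eq_0_iff)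
  then show ?thesis
    using False assms(1)
    by (simp add: bhat_F F_def b_def P_def odd_commutator_def lin_neg[OF lin_Q] lin_neg[OF lin_d])
qed

lemma d_L_add_bhat_L: "homogs xs \<Longrightarrow> d (L xs) + bhat L xs = 0"
proof (induction "length xs" arbitrary: xs rule: less_induct)
  case less
  \<comment> \<open>Prefix and suffix of a proper cut are shorter, so \<open>d_F\<close> applies;
    the terms in \<open>d\<close> then cancel against \<open>d_L\<close>, leaving the two sides of
    \<open>L_assoc\<close>.\<close>
  have dF: "bhat F (take c xs) = d (F (take c xs)) + L (take c xs)"
    "bhat F (drop c xs) = d (F (drop c xs)) + L (drop c xs)" if "c \<in> {1..<length xs}" for c
  proof -
    from that have "take c xs \<noteq> []" "drop c xs \<noteq> []" by auto
    moreover have "d (L (take c xs)) + bhat L (take c xs) = 0" "d (L (drop c xs)) + bhat L (drop c xs) = 0"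
      using that less(1) homogs_take_drop[OF less(2), of c] by auto
    ultimately show "bhat F (take c xs) = d (F (take c xs)) + L (take c xs)"
      "bhat F (drop c xs) = d (F (drop c xs)) + L (drop c xs)"
      using d_F[of "take c xs"] d_F[of "drop c xs"] by (simp_all add: algebra_simps)
  qed
  have "d (L xs) + bhat L xs = (\<Sum>c\<in>{1..<length xs}.
      signed (deg (take c xs)) (mult (L (take c xs)) (F (drop c xs))) - mult (F (take c xs)) (L (drop c xs)))"
    unfolding d_L[OF less(2)] bhat_L sum.distrib[symmetric]
  proof (rule sum.cong[OF refl])
    fix c assume "c \<in> {1..<length xs}"
    note dF = dF[OF this]
    show "mult (F (take c xs)) (d (F (drop c xs)))
        - signed (deg (take c xs)) (mult (d (F (take c xs))) (F (drop c xs)))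
        + (signed (deg (take c xs)) (mult (bhat F (take c xs)) (F (drop c xs)))
        - mult (F (take c xs)) (bhat F (drop c xs)))
      = signed (deg (take c xs)) (mult (L (take c xs)) (F (drop c xs)))
        - mult (F (take c xs)) (L (drop c xs))"
      unfolding dF lin_add[OF mult_linear_left] lin_add[OF mult_linear_right] signed_add by simp
  qed
  also have "\<dots> = 0"
    by (simp only: sum_subtractf L_assoc diff_self)
  finally show ?case .
qed

lemma bhat_b:
  assumes "homogs xs" "xs \<noteq> []"
  shows "bhat b xs = 0"
proof -
  \<comment> \<open>Contracting the whole word leaves \<open>d (b xs)\<close>, which
    \<open>d_P\<close> turns into \<open>P (d (L xs))\<close>; on a single letter both are
    0.\<close>
  have "bhat b xs = d (b xs) + P (bhat L xs)"
    using assms(2) by (subst bhat_linear_cong[of _ P]) (auto simp: b_def lin_P)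
  also have "d (b xs) = P (d (L xs))"
    using assms(2) by (cases "length xs = 1") (auto simp: b_def d_d d_P L_short lin_0[OF lin_d] lin_0[OF lin_P])
  finally show ?thesis
    using d_L_add_bhat_L[OF assms(1)] by (simp add: lin_0[OF lin_P] flip: lin_add[OF lin_P])
qed

section \<open>From homogeneous words to multilinear maps\<close>

abbreviation lambda' :: "'v list \<Rightarrow> 'v" where
  "lambda' \<equiv> lambda scale V0 V1 mult Q"

abbreviation mu' :: "'v list \<Rightarrow> 'v" where
  "mu' \<equiv> mu scale V0 V1 mult d Q"

text \<open>For a fixed choice of parities, an argument reaches the labelled word only through one
  component, at a position independent of its value.\<close>

lemma zip_components_slot:
  fixes ps :: "nat list"
  assumes "length ps = length us + Suc (length ws)"
  shows "\<exists>as q bs. ps = as @ q # bs \<and> length as = length us \<and> (\<forall>x.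
    zip ps (map2 (component V0 V1) ps (us @ x # ws)) = zip as (map2 (component V0 V1) as us)
      @ (q, component V0 V1 q x) # zip bs (map2 (component V0 V1) bs ws))"
proof -
  have "ps = take (length us) ps @ ps ! length us # drop (Suc (length us)) ps"
    using assms by (intro id_take_nth_drop) simp
  moreover obtain as q bs where "as = take (length us) ps" "q = ps ! length us"
    "bs = drop (Suc (length us)) ps" by blast
  ultimately have "ps = as @ q # bs" "length as = length us"
    using assms by auto
  then show ?thesis by (intro exI[of _ as] exI[of _ q] exI[of _ bs]) auto
qed

lemma lin_lambda: "lin (\<lambda>x. lambda' (us @ x # ws))"
proof -
  have c: "lin (component V0 V1 q)" for q
    by (simp add: lin_iff component_add component_scale)
  have "lin (\<lambda>x. lam (zip ps (map2 (component V0 V1) ps (us @ x # ws))))"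
    if "length ps = length us + Suc (length ws)" for ps
    using zip_components_slot[OF that] lin_comp[OF lin_lam c] by auto
  then show ?thesis
    unfolding lambda_def length_append length_Cons by (intro lin_setsum) auto
qed

text \<open>A choice of parities other than the given labels modulo 2 picks a zero component in some
  slot and contributes nothing, by linearity.\<close>

lemma lambda_homogs:
  assumes "homogs xs"
  shows "lambda' (map snd xs) = lam xs"
proof -
  define A where "A = {ps::nat list. length ps = length (map snd xs) \<and> set ps \<subseteq> {0, 1}}"
  define p0 where "p0 = map (\<lambda>(p, v). p mod 2) xs"
  have "A = {ps. set ps \<subseteq> {0, 1} \<and> length ps = length xs}" by (auto simp: A_def)
  then have fin: "finite A" by (simp add: finite_lists_length_eq)
  have p0: "p0 \<in> A" by (auto simp: A_def p0_def)
  have "lam (zip ps (map2 (component V0 V1) ps (map snd xs))) = 0" if ps: "ps \<in> A - {p0}" for ps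
  proof -
    have len: "length ps = length xs" and 01: "set ps \<subseteq> {0, 1}"
      using ps by (auto simp: A_def)
    then obtain i where i: "i < length xs" "ps ! i \<noteq> p0 ! i"
      using ps nth_equalityI[of ps p0] by (auto simp: p0_def)
    obtain p v where pv: "xs ! i = (p, v)" by fastforce
    have "xs = take i xs @ (p, v) # drop (Suc i) xs"
      using id_take_nth_drop[OF i(1)] pv by simp
    then have vs: "map snd xs = map snd (take i xs) @ v # map snd (drop (Suc i) xs)"
      by (metis list.simps(9) map_append snd_conv)
    have v: "v \<in> hom p"
      using assms i(1) pv by (auto simp: list_all_length)
    have "length ps = length (map snd (take i xs)) + Suc (length (map snd (drop (Suc i) xs)))"
      using len i(1) by simp
    from zip_components_slot[OF this] obtain as q bs where q: "ps = as @ q # bs" "length as = length (map snd (take i xs))"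
      and z: "zip ps (map2 (component V0 V1) ps (map snd xs)) = zip as (map2 (component V0 V1) as (map snd (take i xs)))
      @ (q, component V0 V1 q v) # zip bs (map2 (component V0 V1) bs (map snd (drop (Suc i) xs)))"
      unfolding vs by blast
    have "q \<noteq> p mod 2" "q \<in> {0, 1}"
      using i q 01 pv by (auto simp: p0_def nth_append)
    then have "odd (p + q)" by auto presburger+
    then show ?thesis
      using component_homog[OF v] unfolding z by (simp add: lin_0[OF lin_lam])
  qed
  then have "lambda' (map snd xs) = lam (zip p0 (map2 (component V0 V1) p0 (map snd xs)))"
    unfolding lambda_def A_def[symmetric]
    by (subst sum.mono_neutral_right[OF fin, of "{p0}"]) (use p0 in auto)
  also have "zip p0 (map2 (component V0 V1) p0 (map snd xs)) = reduce xs"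
    using assms unfolding p0_def reduce_def
    by (induction xs) (auto simp: component_homog)
  finally show ?thesis by (simp add: lam_reduce)
qed

lemma mu_eq: "mu' vs = (if length vs = 1 then d (hd vs) else P (lambda' vs))"
  by (simp add: mu_def P_def)

lemma lin_mu: "lin (\<lambda>x. mu' (us @ x # ws))"
proof (cases "us = [] \<and> ws = []")
  case True
  then show ?thesis using lin_d by (simp add: mu_eq)
next
  case False
  then have "length (us @ x # ws) \<noteq> 1" for x by auto
  then show ?thesis
    using lin_comp[OF lin_P lin_lambda] by (simp add: mu_eq del: length_append)
qed

lemma b_mu: "xs \<noteq> [] \<Longrightarrow> homogs xs \<Longrightarrow> b xs = signed (susp xs) (mu' (map snd xs))"
  by (cases xs) (auto simp: mu_eq b_def L_def lambda_homogs[symmetric] lin_signed[OF lin_P]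
      lin_neg[OF lin_P] signed_def)

lemma mu_hom:
  assumes "xs \<noteq> []" "homogs xs"
  shows "mu' (map snd xs) \<in> hom (deg xs)"
proof -
  have "mu' (map snd xs) = signed (susp xs) (b xs)"
    using b_mu[OF assms] by (simp add: signed_signed) (simp add: signed_def)
  then show ?thesis
    using b_hom[OF assms] signed_homog by simp
qed

text \<open>The sign \<open>r\<close> of the identity, with \<open>length xs - l\<close> for
  \<open>k - 1\<close>, arises from the sign of the coderivation and the suspension signs of the
  inner and outer operation. The discrepancy \<open>susp xs\<close> depends on the whole word only,
  so it factors out of the sum.\<close>

lemma mu_insert:
  assumes "homogs xs" "(j, l) \<in> subwords (length xs)"
  shows "signed (l * parity (take j xs) + j * (l - 1) + (length xs - l) * l)
      (mu' (take j (map snd xs) @ [mu' (take l (drop j (map snd xs)))] @ drop (j + l) (map snd xs)))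
    = signed (susp xs) (signed (deg (take j xs)) (b (ins j l xs)))"
proof -
  define us ms ws where "us = take j xs" and "ms = take l (drop j xs)" and "ws = drop (j + l) xs"
  have jl: "1 \<le> l" "j + l \<le> length xs" using assms(2) by (auto simp: subwords_def)
  have xs: "xs = us @ ms @ ws"
    by (metis us_def ms_def ws_def append_take_drop_id drop_drop add.commute)
  have len: "length us = j" "length ms = l" using jl by (auto simp: us_def ms_def)
  have hom: "homogs us" "homogs ms" "homogs ws" using assms(1) by (simp_all add: xs)
  have ms: "ms \<noteq> []" using len jl by auto
  have ins: "ins j l xs = us @ [(deg ms, b ms)] @ ws"
    by (simp add: ins_def us_def ms_def ws_def)
  have "b (ins j l xs) = signed (susp (us @ [(deg ms, b ms)] @ ws)) (mu' (map snd us @ b ms # map snd ws))"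
    unfolding ins using hom b_hom[OF ms hom(2)] by (subst b_mu) auto
  also have "mu' (map snd us @ b ms # map snd ws)
      = signed (susp ms) (mu' (map snd us @ mu' (map snd ms) # map snd ws))"
    by (simp only: b_mu[OF ms hom(2)] lin_signed[OF lin_mu])
  finally have b: "b (ins j l xs) = signed (susp (us @ [(deg ms, b ms)] @ ws) + susp ms)
      (mu' (map snd us @ mu' (map snd ms) # map snd ws))"
    by (simp only: signed_signed)
  have vs: "take j (map snd xs) = map snd us" "take l (drop j (map snd xs)) = map snd ms"
    "drop (j + l) (map snd xs) = map snd ws"
    by (simp_all add: us_def ms_def ws_def take_map drop_map)
  obtain l' where l': "l = Suc l'" using jl by (cases l) auto
  \<comment> \<open>Modulo 2 both exponents equal \<open>l * parity us + j + l * length ws\<close>,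
    as \<open>length xs - l\<close> is \<open>j + length ws\<close>.\<close>
  have "even ((l * parity us + j * (l - 1) + (length xs - l) * l)
      + (susp xs + (deg us + (susp (us @ [(deg ms, b ms)] @ ws) + susp ms))))"
    using len unfolding xs susp_append l' by (auto simp: deg_def l')
  then show ?thesis
    unfolding b vs us_def[symmetric] signed_signed by (simp add: signed_cong)
qed

lemma mu_associativity:
  assumes "homogs xs" "xs \<noteq> []" "length xs = n"
  shows "(\<Sum>(k, l) \<in> {(k, l). k + l = n + 1 \<and> k \<ge> 1 \<and> l \<ge> 1}. \<Sum>j = 0..k - 1.
      signed (l * parity (take j xs) + j * (l - 1) + (k - 1) * l)
        (mu' (take j (map snd xs) @ [mu' (take l (drop j (map snd xs)))] @ drop (j + l) (map snd xs)))) = 0"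
proof -
  define T where "T j l = signed (susp xs) (signed (deg (take j xs)) (b (ins j l xs)))" for j l
  define K where "K = {(k, l). k + l = n + 1 \<and> k \<ge> 1 \<and> l \<ge> (1::nat)}"
  have fin: "finite K"
    by (rule finite_subset[of _ "{0..n+1} \<times> {0..n+1}"]) (auto simp: K_def)
  have "(\<Sum>(k, l)\<in>K. \<Sum>j = 0..k - 1. signed (l * parity (take j xs) + j * (l - 1) + (k - 1) * l)
        (mu' (take j (map snd xs) @ [mu' (take l (drop j (map snd xs)))] @ drop (j + l) (map snd xs))))
      = (\<Sum>(k, l)\<in>K. \<Sum>j = 0..k - 1. T j l)"
  proof (rule sum.cong[OF refl], clarify, rule sum.cong[OF refl])
    fix k l j assume "(k, l) \<in> K" "j \<in> {0..k - 1}"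
    then have "(j, l) \<in> subwords (length xs)" "k - 1 = length xs - l"
      using assms(3) by (auto simp: K_def subwords_def)
    then show "signed (l * parity (take j xs) + j * (l - 1) + (k - 1) * l)
        (mu' (take j (map snd xs) @ [mu' (take l (drop j (map snd xs)))] @ drop (j + l) (map snd xs)))
      = T j l"
      unfolding T_def using mu_insert[OF assms(1)] by simp
  qed
  also have "\<dots> = (\<Sum>(kl, j)\<in>(SIGMA kl:K. {0..fst kl - 1}). T j (snd kl))"
    using fin by (simp add: sum.Sigma case_prod_unfold)
  \<comment> \<open>As \<open>k - 1 = n - l\<close>, the range of \<open>j\<close> says
    \<open>j + l \<le> n\<close>, and \<open>k\<close> is recovered as
    \<open>n + 1 - l\<close>.\<close>
  also have "\<dots> = (\<Sum>(j, l)\<in>subwords n. T j l)"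
    by (rule sum.reindex_bij_witness[of _ "\<lambda>(j, l). ((n + 1 - l, l), j)" "\<lambda>(kl, j). (j, snd kl)"])
      (auto simp: K_def subwords_def)
  also have "\<dots> = signed (susp xs) (bhat b xs)"
    by (simp add: T_def bhat_def signed_sum case_prod_unfold assms(3))
  finally show ?thesis
    using bhat_b[OF assms(1,2)] by (simp add: K_def)
qed

end

section \<open>The induced structure on \<open>W\<close>\<close>

theorem theorem3p4:
  fixes scale :: "'k::field \<Rightarrow> 'v::ab_group_add \<Rightarrow> 'v"
    and V0 V1 W :: "'v set"
    and mult :: "'v \<Rightarrow> 'v \<Rightarrow> 'v"
    and d Q :: "'v \<Rightarrow> 'v"
  assumes "diff_assoc_superalgebra scale V0 V1 mult d"
    and "subcomplex scale V0 V1 d W"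
    and "odd_operator scale V0 V1 Q"
    and "\<And>v. v - odd_commutator d Q v \<in> W"
  shows "A_infinity_algebra scale W (W \<inter> V0) (W \<inter> V1) (mu scale V0 V1 mult d Q)"
proof -
  interpret homotopy_transfer scale V0 V1 mult d Q
    using assms(1,3) by (simp add: homotopy_transfer_def homotopy_transfer_axioms_def)
  interpret W: vector_superspace scale W "W \<inter> V0" "W \<inter> V1"
    using assms(2) by (simp add: subcomplex_def)
  \<comment> \<open>A single letter stays in \<open>W\<close> because \<open>W\<close> is a
    subcomplex; on longer words the value lies in \<open>W\<close> because \<open>P\<close> maps
    everything there.\<close>
  have closed: "mu' vs \<in> W" if "vs \<noteq> []" "set vs \<subseteq> W" for vs
    using that assms(2,4) by (cases vs) (auto simp: mu_eq P_def subcomplex_def)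
  have homW: "homog (W \<inter> V0) (W \<inter> V1) p = W \<inter> hom p" for p
    by (simp add: homog_def)
  have zip: "map snd (zip ps vs) = vs" "map fst (zip ps vs) = ps" "homogs (zip ps vs)" "set vs \<subseteq> W"
    "length ps = length vs"
    if "list_all2 (\<lambda>p v. v \<in> homog (W \<inter> V0) (W \<inter> V1) p) ps vs" for ps and vs :: "'v list"
    using that by (auto simp: homW list_all2_conv_all_nth list_all_iff set_zip in_set_conv_nth)
  show ?thesis
  proof
    show "mu' vs \<in> W" if "vs \<noteq> []" "set vs \<subseteq> W" for vs
      using closed that .
    show "mu' (us @ (x + y) # ws) = mu' (us @ x # ws) + mu' (us @ y # ws)" for us x y ws
      by (rule lin_add[OF lin_mu])
    show "mu' (us @ scale c x # ws) = scale c (mu' (us @ x # ws))" for us c x ws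
      by (rule lin_scale[OF lin_mu])
  next
    fix ps :: "nat list" and vs :: "'v list"
    assume vs: "vs \<noteq> []" and h: "list_all2 (\<lambda>p v. v \<in> homog (W \<inter> V0) (W \<inter> V1) p) ps vs"
    have "zip ps vs \<noteq> []" using vs zip(1)[OF h] by auto
    then have "mu' vs \<in> hom (sum_list ps + length vs)"
      using mu_hom[of "zip ps vs"] zip[OF h] by (simp add: deg_def parity_def)
    then show "mu' vs \<in> homog (W \<inter> V0) (W \<inter> V1) (sum_list ps + length vs)"
      using closed vs zip[OF h] by (simp add: homW)
  next
    fix n :: nat and ps :: "nat list" and vs :: "'v list"
    assume n: "n \<ge> 1" "length vs = n" and h: "list_all2 (\<lambda>p v. v \<in> homog (W \<inter> V0) (W \<inter> V1) p) ps vs"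
    have "zip ps vs \<noteq> []" "length (zip ps vs) = n" using n zip(1,5)[OF h] by auto
    from mu_associativity[OF zip(3)[OF h] this]
    show "(\<Sum>(k, l) \<in> {(k, l). k + l = n + 1 \<and> k \<ge> 1 \<and> l \<ge> 1}. \<Sum>j = 0..k - 1.
            scale ((-1) ^ (l * sum_list (take j ps) + j * (l - 1) + (k - 1) * l))
              (mu' (take j vs @ [mu' (take l (drop j vs))] @ drop (j + l) vs))) = 0"
      by (simp only: scale_sign parity_def take_map[symmetric] zip(1,2)[OF h])
  qed
qed

end
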